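(* Let $T$ be any rational differential operator on $\mathbb{C}P^1$, let $N\ge1$, and let $T_{z_i}$ denote the differential operator on $(\mathbb{C}P^1)^N$ (with coordinates $z_1,\ldots,z_N$) acting as $T$ on the $i$th variable. Let $P_1,\ldots,P_N$ be distinct points of $\mathbb{C}$. For $k=1,\ldots,N$ set $$H_k=\sum_{i=1}^N\frac{\prod_{(i',k')\,|\,i'=i\text{ or }k'=k}(z_{i'}-P_{k'})}{\prod_{i'\,|\,i'\neq i}(z_i-z_{i'})}\cdot T_{z_i}.$$ Then $(H_1,\ldots,H_N)$ is a commuting family of rational differential operators on $(\mathbb{C}P^1)^N$.
   Context: A rational differential operator on $(\mathbb{C}P^1)^N$ is a differential operator in $z_1,\ldots,z_N$ with coefficients in $\mathbb{C}(z_1,\ldots,z_N)$, viewed as an endomorphism of $\mathbb{C}(z_1,\ldots,z_N)$ (for $N=1$, a rational differential operator on $\mathbb{C}P^1$). In the numerator, the product is over the set of pairs $(i',k')\in\{1,\ldots,N\}^2$ such that $i'=i$ or $k'=k$ (so the pair $(i,k)$ contributes exactly one factor). The product with $T_{z_i}$ is composition of multiplication by the rational function after applying $T_{z_i}$. *)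

theory Defs
  imports
    Complex_Main
    "HOL-Library.Poly_Mapping"
    "HOL-Computational_Algebra.Fraction_Field"
begin

section \<open>Polynomials and rational functions in finitely many variables\<close>

text \<open>
  The variables are indexed by a finite, linearly ordered type \<open>'n\<close>, which plays the role of the
  index set \<open>{1, \<dots>, N}\<close>. A monomial is its exponent vector. The linear order is only needed
  because the library derives the absence of zero divisors from it.
\<close>

type_synonym 'n cpoly = "('n \<Rightarrow>\<^sub>0 nat) \<Rightarrow>\<^sub>0 complex"
type_synonym 'n ratfun = "'n cpoly fract"

definition const :: "complex \<Rightarrow> 'n::linorder ratfun" where
  "const c = Fract (Poly_Mapping.single 0 c) 1"

definition var :: "'n \<Rightarrow> 'n::linorder ratfun" where
  "var i = Fract (Poly_Mapping.single (Poly_Mapping.single i 1) 1) 1"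

lemma cpoly_induct [case_names zero single add]:
  fixes p :: "'a \<Rightarrow>\<^sub>0 'b::comm_monoid_add"
  assumes "Q 0" "\<And>m c. Q (Poly_Mapping.single m c)" "\<And>p q. Q p \<Longrightarrow> Q q \<Longrightarrow> Q (p + q)"
  shows "Q p"
proof (induction p rule: Poly_Mapping.update_induct)
  case const
  show ?case by fact
next
  case (update f a b)
  have "Poly_Mapping.update a b f = f + Poly_Mapping.single a b"
    using update(1)
    by (intro poly_mapping_eqI)
      (auto simp: lookup_update lookup_add lookup_single when_def in_keys_iff)
  then show ?case using assms update by metis
qed


section \<open>Partial derivatives\<close>

text \<open>The truncated subtraction of exponents is harmless: where it truncates, the coefficient is 0.\<close>

definition poly_pd :: "'n \<Rightarrow> 'n cpoly \<Rightarrow> 'n cpoly" where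
  "poly_pd i p = (\<Sum>m\<in>Poly_Mapping.keys p.
     Poly_Mapping.single (m - Poly_Mapping.single i 1)
       (of_nat (Poly_Mapping.lookup m i) * Poly_Mapping.lookup p m))"

lemma poly_pd_0 [simp]: "poly_pd i 0 = 0"
  by (simp add: poly_pd_def)

lemma poly_pd_single:
  "poly_pd i (Poly_Mapping.single m c) =
     Poly_Mapping.single (m - Poly_Mapping.single i 1) (of_nat (Poly_Mapping.lookup m i) * c)"
  by (cases "c = 0") (simp_all add: poly_pd_def)

lemma poly_pd_add: "poly_pd i (p + q) = poly_pd i p + poly_pd i q"
  unfolding poly_pd_def
  by (rule setsum_keys_plus_distrib) (simp_all add: single_add[symmetric] algebra_simps)

lemma poly_pd_mult: "poly_pd i (p * q) = poly_pd i p * q + p * poly_pd i q"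
proof (induction p rule: cpoly_induct)
  case (single m c)
  show ?case
  proof (induction q rule: cpoly_induct)
    case (single n d)
    have eq1: "m + n - Poly_Mapping.single i 1 = m - Poly_Mapping.single i 1 + n"
      if "Poly_Mapping.lookup m i \<noteq> 0"
      using that by (intro poly_mapping_eqI)
        (auto simp: lookup_add lookup_minus lookup_single when_def)
    have eq2: "m + n - Poly_Mapping.single i 1 = m + (n - Poly_Mapping.single i 1)"
      if "Poly_Mapping.lookup n i \<noteq> 0"
      using that by (intro poly_mapping_eqI)
        (auto simp: lookup_add lookup_minus lookup_single when_def)
    show ?case
      using eq1 eq2
      by (cases "Poly_Mapping.lookup m i = 0"; cases "Poly_Mapping.lookup n i = 0")
        (simp_all add: poly_pd_single mult_single lookup_add single_add[symmetric] algebra_simps)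
  qed (simp_all add: poly_pd_add algebra_simps)
qed (simp_all add: poly_pd_add algebra_simps)

lift_definition pd :: "'n::linorder \<Rightarrow> 'n ratfun \<Rightarrow> 'n ratfun"
  is "\<lambda>i (a, b). (poly_pd i a * b - a * poly_pd i b, b * b)"
proof (clarsimp, goal_cases)
  case (1 i a b a' b')
  define A B A' B' where D: "A = poly_pd i a" "B = poly_pd i b" "A' = poly_pd i a'" "B' = poly_pd i b'"
  have "A * b' + a * B' = A' * b + a' * B"
    using arg_cong[OF 1(3), of "poly_pd i"] by (simp add: poly_pd_mult D)
  then have *: "A * b' - A' * b = a' * B - a * B'"
    by (simp add: algebra_simps)
  have "(A * b - a * B) * (b' * b') - (A' * b' - a' * B') * (b * b) =
        b * b' * (A * b' - A' * b) - a * b' * b' * B + a' * b * b * B'"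
    by (simp add: algebra_simps)
  also have "\<dots> = (B * b' + b * B') * (a' * b - a * b')"
    unfolding * by (simp add: algebra_simps)
  also have "\<dots> = 0"
    by (simp only: 1(3) diff_self mult_zero_right)
  finally show ?case
    by (simp only: D right_minus_eq)
qed

lemma pd_Fract:
  "b \<noteq> 0 \<Longrightarrow> pd i (Fract a b) = Fract (poly_pd i a * b - a * poly_pd i b) (b * b)"
  by (simp add: Fract_def pd.abs_eq)


section \<open>Rational differential operators\<close>

text \<open>The partial derivatives commute, so the order in which they are composed is immaterial.\<close>

definition pds :: "('n \<Rightarrow>\<^sub>0 nat) \<Rightarrow> 'n::{finite,linorder} ratfun \<Rightarrow> 'n ratfun" where
  "pds \<alpha> = foldr (\<lambda>i. pd i ^^ Poly_Mapping.lookup \<alpha> i) (sorted_list_of_set UNIV)"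

definition diff_op :: "(('n \<Rightarrow>\<^sub>0 nat) \<Rightarrow>\<^sub>0 'n ratfun) \<Rightarrow> 'n::{finite,linorder} ratfun \<Rightarrow> 'n ratfun" where
  "diff_op c f = (\<Sum>\<alpha>\<in>Poly_Mapping.keys c. Poly_Mapping.lookup c \<alpha> * pds \<alpha> f)"

definition rational_diff_op :: "('n::{finite,linorder} ratfun \<Rightarrow> 'n ratfun) \<Rightarrow> bool" where
  "rational_diff_op D \<longleftrightarrow> (\<exists>c. D = diff_op c)"


section \<open>Letting a one-variable operator act on the \<open>i\<close>th variable\<close>

text \<open>Rational functions in one variable are those indexed by the one-element type \<^typ>\<open>unit\<close>.
  The following maps substitute \<open>z\<^sub>i\<close> for that variable.\<close>

definition poly_subst :: "'n \<Rightarrow> unit cpoly \<Rightarrow> 'n cpoly" where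
  "poly_subst i p = (\<Sum>m\<in>Poly_Mapping.keys p.
     Poly_Mapping.single (Poly_Mapping.single i (Poly_Mapping.lookup m ())) (Poly_Mapping.lookup p m))"

lemma poly_subst_0 [simp]: "poly_subst i 0 = 0"
  by (simp add: poly_subst_def)

lemma poly_subst_single:
  "poly_subst i (Poly_Mapping.single m c) =
     Poly_Mapping.single (Poly_Mapping.single i (Poly_Mapping.lookup m ())) c"
  by (cases "c = 0") (simp_all add: poly_subst_def)

lemma poly_subst_add: "poly_subst i (p + q) = poly_subst i p + poly_subst i q"
  unfolding poly_subst_def
  by (rule setsum_keys_plus_distrib) (simp_all add: single_add)

lemma poly_subst_mult: "poly_subst i (p * q) = poly_subst i p * poly_subst i q"
proof (induction p rule: cpoly_induct)
  case (single m c)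
  show ?case
    by (induction q rule: cpoly_induct)
      (simp_all add: poly_subst_single poly_subst_add mult_single lookup_add single_add algebra_simps)
qed (simp_all add: poly_subst_add algebra_simps)

lemma lookup_poly_subst:
  "Poly_Mapping.lookup (poly_subst i p) (Poly_Mapping.single i (Poly_Mapping.lookup m ())) =
     Poly_Mapping.lookup p m"
proof (induction p rule: cpoly_induct)
  case (single n c)
  have "Poly_Mapping.single i (Poly_Mapping.lookup n ()) =
      Poly_Mapping.single i (Poly_Mapping.lookup m ()) \<longleftrightarrow> n = m"
    by (auto dest!: injD[OF inj_single] intro!: poly_mapping_eqI)
  then show ?case
    by (auto simp: poly_subst_single lookup_single when_def)
qed (simp_all add: poly_subst_add lookup_add)

lemma poly_subst_eq_0_iff: "poly_subst i p = 0 \<longleftrightarrow> p = 0"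
proof
  assume "poly_subst i p = 0"
  then show "p = 0"
    using lookup_poly_subst[of i p] by (intro poly_mapping_eqI) simp
qed simp

lift_definition subst :: "'n::linorder \<Rightarrow> unit ratfun \<Rightarrow> 'n ratfun"
  is "\<lambda>i (a, b). (poly_subst i a, poly_subst i b)"
  by (clarsimp simp: poly_subst_eq_0_iff poly_subst_mult[symmetric])

lemma subst_Fract: "b \<noteq> 0 \<Longrightarrow> subst i (Fract a b) = Fract (poly_subst i a) (poly_subst i b)"
  by (simp add: Fract_def subst.abs_eq poly_subst_eq_0_iff)

text \<open>
  If \<open>T = \<Sum>\<^sub>m c\<^sub>m(z) (d/dz)\<^sup>m\<close>, then \<open>T\<close> acting on the \<open>i\<close>th variable is
  \<open>\<Sum>\<^sub>m c\<^sub>m(z\<^sub>i) (\<partial>/\<partial>z\<^sub>i)\<^sup>m\<close>. The coefficients are determined by \<open>T\<close> as an endomorphism; see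
  \<open>diff_op_unit_inject\<close> below.
\<close>

definition on_var :: "'n \<Rightarrow> (unit ratfun \<Rightarrow> unit ratfun) \<Rightarrow> 'n::{finite,linorder} ratfun \<Rightarrow> 'n ratfun" where
  "on_var i T f = (let c = (THE c. T = diff_op c) in
     \<Sum>m\<in>Poly_Mapping.keys c.
       subst i (Poly_Mapping.lookup c m) * (pd i ^^ Poly_Mapping.lookup m ()) f)"

lemma ratfun_of_nat_eq_0_iff: "of_nat k = (0 :: unit ratfun) \<longleftrightarrow> k = 0"
  unfolding of_nat_fract Zero_fract_def by (simp add: eq_fract(1))

lemma pd_var_power:
  "pd i (of_nat a * var i ^ n) = of_nat (a * n) * var i ^ (n - 1)"
proof -
  have single: "of_nat a * var i ^ n = Fract (Poly_Mapping.single (Poly_Mapping.single i n) (of_nat a)) 1"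
    for a n and i :: "'a::linorder"
  proof -
    have "var i ^ n = Fract (Poly_Mapping.single (Poly_Mapping.single i n) 1) 1"
    proof (induction n)
      case (Suc n)
      then show ?case
        using single_add[of i 1 n, symmetric] by (simp add: var_def mult_single)
    qed (simp add: One_fract_def)
    then show ?thesis
      by (simp add: of_nat_fract mult_single flip: single_of_nat)
  qed
  have "poly_pd i 1 = 0"
    using poly_pd_single[of i 0 1] by simp
  then show ?thesis
    unfolding single
    by (simp only: pd_Fract[OF one_neq_zero] poly_pd_single single_diff[symmetric]
        lookup_single_eq of_nat_mult mult.commute mult_1_right mult_1_left mult_zero_left diff_zero)
qed

lemma pd_power_var_power:
  "(pd i ^^ k) (var i ^ n) = of_nat (\<Prod>j<k. n - j) * var i ^ (n - k)"
proof (induction k)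
  case (Suc k)
  then show ?case by (simp add: pd_var_power del: of_nat_prod of_nat_mult)
qed simp

lemma pds_unit: "pds \<alpha> = pd () ^^ Poly_Mapping.lookup \<alpha> ()"
proof -
  have "sorted_list_of_set (UNIV :: unit set) = [()]"
    by (simp add: UNIV_unit)
  then show ?thesis by (simp add: pds_def)
qed

lemma diff_op_unit_inject:
  fixes c d :: "(unit \<Rightarrow>\<^sub>0 nat) \<Rightarrow>\<^sub>0 unit ratfun"
  shows "diff_op c = diff_op d \<longleftrightarrow> c = d"
proof
  assume eq: "diff_op c = diff_op d"
  let ?S = "Poly_Mapping.keys c \<union> Poly_Mapping.keys d"
  have expand: "diff_op e f = (\<Sum>\<alpha>\<in>?S. Poly_Mapping.lookup e \<alpha> * pds \<alpha> f)"
    if "Poly_Mapping.keys e \<subseteq> ?S" for e f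
    unfolding diff_op_def using that
    by (intro sum.mono_neutral_left) (auto simp: in_keys_iff)
  define \<delta> where "\<delta> \<alpha> = Poly_Mapping.lookup c \<alpha> - Poly_Mapping.lookup d \<alpha>" for \<alpha>
  have zero: "(\<Sum>\<alpha>\<in>?S. \<delta> \<alpha> * pds \<alpha> f) = 0" for f
    using expand[of c f] expand[of d f] fun_cong[OF eq, of f]
    by (simp add: \<delta>_def left_diff_distrib sum_subtractf)
  have "\<delta> \<alpha> = 0" if "Poly_Mapping.lookup \<alpha> () = n" for \<alpha> n
    using that
  proof (induction n arbitrary: \<alpha> rule: less_induct)
    case (less n)
    have "\<delta> \<beta> * pds \<beta> (var () ^ n) = 0" if "\<beta> \<noteq> \<alpha>" for \<beta>
    proof -
      have ne: "Poly_Mapping.lookup \<beta> () \<noteq> n"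
        using that less.prems by (metis (full_types) old.unit.exhaust poly_mapping_eqI)
      show ?thesis
      proof (cases "Poly_Mapping.lookup \<beta> () < n")
        case True
        then show ?thesis using less.IH by simp
      next
        case False
        with ne have "(\<Prod>j<Poly_Mapping.lookup \<beta> (). n - j) = 0"
          by (intro prod_zero) auto
        then show ?thesis by (simp add: pds_unit pd_power_var_power del: of_nat_prod prod_zero_iff)
      qed
    qed
    then have "(\<Sum>\<beta>\<in>?S. \<delta> \<beta> * pds \<beta> (var () ^ n)) =
        (\<Sum>\<beta>\<in>?S. if \<beta> = \<alpha> then \<delta> \<alpha> * pds \<alpha> (var () ^ n) else 0)"
      by (intro sum.cong) auto
    then have "\<alpha> \<in> ?S \<Longrightarrow> \<delta> \<alpha> * pds \<alpha> (var () ^ n) = 0"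
      using zero[of "var () ^ n"] by simp
    moreover have "pds \<alpha> (var () ^ n) \<noteq> 0"
    proof -
      have "(\<Prod>j<n. n - j) \<noteq> 0"
        by simp
      then show ?thesis
        using less.prems ratfun_of_nat_eq_0_iff
        by (simp add: pds_unit pd_power_var_power del: prod_zero_iff of_nat_prod)
    qed
    moreover have "\<alpha> \<notin> ?S \<Longrightarrow> \<delta> \<alpha> = 0"
      by (auto simp: \<delta>_def in_keys_iff)
    ultimately show ?case by auto
  qed
  then show "c = d"
    by (intro poly_mapping_eqI) (simp add: \<delta>_def)
qed simp

lemma on_var_diff_op:
  "on_var i (diff_op c) f =
     (\<Sum>m\<in>Poly_Mapping.keys c.
       subst i (Poly_Mapping.lookup c m) * (pd i ^^ Poly_Mapping.lookup m ()) f)"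
proof -
  have "(THE c'. diff_op c = diff_op c') = c"
    by (rule the_equality) (simp_all add: diff_op_unit_inject)
  then show ?thesis by (simp add: on_var_def)
qed

end

theory Submission
  imports
    Defs
    "HOL-Computational_Algebra.Polynomial"
    "HOL-Analysis.Cartesian_Space"
begin

text \<open>
  The coefficient of \<open>T\<^sub>i\<close> in \<open>H\<^sub>k\<close> is, up to transposition, an entry of the inverse of the matrix
  \<open>S\<^sub>i\<^sub>k = 1 / ((z\<^sub>i - P\<^sub>k) d\<^sub>k)\<close>, where \<open>d\<^sub>k\<close> is the product of all \<open>P\<^sub>k\<^sub>' - P\<^sub>k\<close> with \<open>k' \<noteq> k\<close>; this is a
  rescaled Cauchy matrix, inverted by Lagrange interpolation. Hence \<open>T\<^sub>i = \<Sum>\<^sub>k S\<^sub>i\<^sub>k H\<^sub>k\<close>. The \<open>j\<close>th row of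
  \<open>S\<close> only involves \<open>z\<^sub>j\<close>, so it commutes with \<open>T\<^sub>i\<close> for \<open>i \<noteq> j\<close>, and \<open>T\<^sub>i T\<^sub>j = T\<^sub>j T\<^sub>i\<close> becomes
  \<open>\<Sum>\<^sub>k\<^sub>,\<^sub>l S\<^sub>i\<^sub>k S\<^sub>j\<^sub>l [H\<^sub>k, H\<^sub>l] = 0\<close>, which for \<open>i = j\<close> holds by antisymmetry. Since \<open>S\<close> is invertible,
  all commutators vanish.
\<close>

section \<open>The inverse of a Cauchy matrix\<close>

text \<open>The interpolant \<open>q\<close> and \<open>p\<close> both have degree below
  \<open>card K\<close> and agree at the \<open>card K\<close> distinct nodes \<open>y k\<close>, so
  they coincide.\<close>

lemma lagrange_interpolation:
  fixes y :: "'k \<Rightarrow> 'a::field" and p :: "'a poly"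
  assumes "finite K" "inj_on y K" "degree p < card K"
  shows "poly p t = (\<Sum>k\<in>K. poly p (y k) * (\<Prod>k'\<in>K - {k}. (t - y k') / (y k - y k')))"
proof -
  define b where "b k = (\<Prod>k'\<in>K - {k}. smult (inverse (y k - y k')) [:- y k', 1:])" for k
  define q where "q = (\<Sum>k\<in>K. smult (poly p (y k)) (b k))"
  have poly_b: "poly (b k) s = (\<Prod>k'\<in>K - {k}. (s - y k') / (y k - y k'))" for k s
    by (simp add: b_def poly_prod divide_inverse algebra_simps)
  have "degree (b k) \<le> card K - 1" if "k \<in> K" for k
  proof -
    have "degree (b k) \<le> (\<Sum>k'\<in>K - {k}. degree (smult (inverse (y k - y k')) [:- y k', 1:]))"
      using degree_prod_sum_le[of "K - {k}"] assms(1) unfolding b_def o_def by blast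
    also have "\<dots> \<le> (\<Sum>k'\<in>K - {k}. 1)"
      by (intro sum_mono order_trans[OF degree_smult_le]) simp
    finally show ?thesis
      using that assms(1) by simp
  qed
  then have "degree q \<le> card K - 1"
    unfolding q_def
    by (intro degree_sum_le assms(1)) (meson degree_smult_le order_trans)
  \<comment> \<open>The bound on \<open>degree p\<close> forces \<open>K\<close> to be nonempty, so
    the truncated \<open>card K - 1\<close> really is smaller than \<open>card K\<close>.\<close>
  then have "degree q < card K"
    using assms(3) by linarith
  moreover have "poly p (y k) = poly q (y k)" if "k \<in> K" for k
  proof -
    have "poly (b l) (y k) = (if k = l then 1 else 0)" if "l \<in> K" for l
    proof (cases "k = l")
      case True
      have "(\<Prod>k'\<in>K - {k}. (y k - y k') / (y k - y k')) = (\<Prod>k'\<in>K - {k}. 1)"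
        using assms(2) \<open>k \<in> K\<close> by (intro prod.cong) (auto dest: inj_onD)
      then show ?thesis using True by (simp add: poly_b)
    next
      case False
      then show ?thesis
        using \<open>k \<in> K\<close> assms(1) by (auto simp: poly_b intro!: prod_zero)
    qed
    then have "poly q (y k) = (\<Sum>l\<in>K. if l = k then poly p (y k) else 0)"
      by (auto simp: q_def poly_sum intro!: sum.cong)
    then show ?thesis
      using that assms(1) by simp
  qed
  moreover have "card (y ` K) = card K"
    using assms(2) by (rule card_image)
  ultimately have "p = q"
    using assms(3) by (intro poly_eqI_degree[of "y ` K"]) auto
  then have "poly p t = poly q t" by simp
  also have "\<dots> = (\<Sum>k\<in>K. poly p (y k) * (\<Prod>k'\<in>K - {k}. (t - y k') / (y k - y k')))"
    by (simp add: q_def poly_sum poly_b)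
  finally show ?thesis .
qed

lemma prod_diff_commute:
  fixes f g :: "'i \<Rightarrow> 'a::comm_ring_1"
  shows "(\<Prod>i\<in>A. f i - g i) = (-1) ^ card A * (\<Prod>i\<in>A. g i - f i)"
  using prod_uminus[of "\<lambda>i. g i - f i" A] by simp

text \<open>Let \<open>p\<close> be the Lagrange basis polynomial with value 1 at \<open>x j\<close>
  and 0 at the other \<open>x i'\<close>. Interpolating \<open>p\<close> at the nodes
  \<open>y k\<close> and evaluating at \<open>x i\<close> gives the sum on the left, up to a factor
  that is 1 for \<open>i = j\<close>.\<close>

lemma cauchy_matrix_right_inverse:
  fixes x y :: "'n::finite \<Rightarrow> 'a::field"
  assumes x: "inj x" and y: "inj y" and xy: "\<And>i k. x i \<noteq> y k"
  shows "(\<Sum>k\<in>UNIV. 1 / ((x i - y k) * (\<Prod>k'\<in>-{k}. y k' - y k)) *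
      ((\<Prod>k'\<in>UNIV. x j - y k') * (\<Prod>i'\<in>-{j}. x i' - y k) / (\<Prod>i'\<in>-{j}. x j - x i'))) =
    (if i = j then 1 else 0)" (is "?lhs = _")
proof -
  define p where "p = (\<Prod>i'\<in>-{j}. smult (inverse (x j - x i')) [:- x i', 1:])"
  have poly_p: "poly p t = (\<Prod>i'\<in>-{j}. t - x i') / (\<Prod>i'\<in>-{j}. x j - x i')" for t
    unfolding prod_dividef[symmetric] by (simp add: p_def poly_prod divide_inverse algebra_simps)
  have card: "card (-{k}) = CARD('n) - 1" for k :: 'n
    by (simp add: Compl_eq_Diff_UNIV card_Diff_singleton)
  have nz: "(\<Prod>i'\<in>-{j}. x j - x i') \<noteq> 0"
    using x by (auto dest: injD)
  have "degree p \<le> (\<Sum>i'\<in>-{j}. degree (smult (inverse (x j - x i')) [:- x i', 1:]))"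
    using degree_prod_sum_le[OF finite, of _ "-{j}"] unfolding p_def o_def by blast
  also have "\<dots> \<le> (\<Sum>i'\<in>-{j}. 1)"
    by (intro sum_mono order_trans[OF degree_smult_le]) simp
  finally have "degree p < CARD('n)"
    by (simp add: card) (metis One_nat_def Suc_pred less_Suc_eq_le zero_less_card_finite)
  from lagrange_interpolation[OF finite y this, of "x i"]
  have interp: "poly p (x i) =
      (\<Sum>k\<in>UNIV. poly p (y k) * (\<Prod>k'\<in>-{k}. (x i - y k') / (y k - y k')))"
    by (simp add: Compl_eq_Diff_UNIV)
  have p_x: "poly p (x i) = (if i = j then 1 else 0)"
    using nz by (auto simp: poly_p)
  \<comment> \<open>The product over all \<open>k'\<close> is taken at \<open>x i\<close> here, not
    at \<open>x j\<close>. The signs from reversing the differences in two products of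
    \<open>CARD('n) - 1\<close> factors cancel.\<close>
  have term_eq: "1 / ((x i - y k) * (\<Prod>k'\<in>-{k}. y k' - y k)) *
      ((\<Prod>k'\<in>UNIV. x i - y k') * (\<Prod>i'\<in>-{j}. x i' - y k) / (\<Prod>i'\<in>-{j}. x j - x i')) =
    poly p (y k) * (\<Prod>k'\<in>-{k}. (x i - y k') / (y k - y k'))" for k
  proof -
    have "(\<Prod>k'\<in>UNIV. x i - y k') = (x i - y k) * (\<Prod>k'\<in>-{k}. x i - y k')"
      by (subst prod.remove[of _ k]) (simp_all add: Compl_eq_Diff_UNIV)
    moreover have "(\<Prod>i'\<in>-{j}. x i' - y k) = (-1) ^ (CARD('n) - 1) * (\<Prod>i'\<in>-{j}. y k - x i')"
      by (subst prod_diff_commute) (simp add: card)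
    moreover have "(\<Prod>k'\<in>-{k}. y k' - y k) = (-1) ^ (CARD('n) - 1) * (\<Prod>k'\<in>-{k}. y k - y k')"
      by (subst prod_diff_commute) (simp add: card)
    ultimately show ?thesis
      using xy[of i k] by (simp add: poly_p prod_dividef mult.commute)
  qed
  \<comment> \<open>The factor \<open>c\<close> restores \<open>x j\<close> in the numerator. It is
    1 if \<open>i = j\<close>; otherwise its value is irrelevant, as \<open>poly p (x i)\<close>
    vanishes.\<close>
  define c where "c = (\<Prod>k'\<in>UNIV. x j - y k') / (\<Prod>k'\<in>UNIV. x i - y k')"
  have "(\<Prod>k'\<in>UNIV. x j - y k') = c * (\<Prod>k'\<in>UNIV. x i - y k')"
    using xy by (simp add: c_def)
  then have "?lhs = c * (\<Sum>k\<in>UNIV. poly p (y k) * (\<Prod>k'\<in>-{k}. (x i - y k') / (y k - y k')))"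
    unfolding term_eq[symmetric] by (simp add: sum_distrib_left mult_ac)
  also have "\<dots> = c * poly p (x i)"
    by (simp only: interp)
  also have "\<dots> = (if i = j then 1 else 0)"
    using xy by (simp add: p_x c_def)
  finally show ?thesis .
qed


section \<open>Commuting operators from an invertible matrix\<close>

text \<open>The commutators are evaluated at one fixed \<open>f\<close>, so they form a matrix of
  field elements \<open>D k l\<close>, and inverting \<open>S\<close> once in each index shows that
  it vanishes.\<close>

lemma commute_if_rows_separated:
  fixes S B :: "'n::finite \<Rightarrow> 'n \<Rightarrow> 'a::field" and U H :: "'n \<Rightarrow> 'a \<Rightarrow> 'a"
  assumes add: "\<And>i f g. U i (f + g) = U i f + U i g"
    and comm: "\<And>i j f. U i (U j f) = U j (U i f)"
    and row: "\<And>i j l f. i \<noteq> j \<Longrightarrow> U i (S j l * f) = S j l * U i f"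
    and inv: "\<And>i j. (\<Sum>k\<in>UNIV. S i k * B j k) = (if i = j then 1 else 0)"
    and H: "\<And>k f. H k f = (\<Sum>i\<in>UNIV. B i k * U i f)"
  shows "H k (H l f) = H l (H k f)"
proof -
  \<comment> \<open>A one-sided inverse of a square matrix over a field is two-sided. The hypothesis
    \<open>inv\<close> recovers \<open>U\<close> from \<open>H\<close>; the other order gives the
    injectivity of \<open>S\<close>.\<close>
  have inv': "(\<Sum>i\<in>UNIV. B i k * S i l) = (if k = l then 1 else 0)" for k l
  proof -
    define M N :: "'a ^ 'n ^ 'n" where MN: "M = (\<chi> i k. S i k)" "N = (\<chi> k j. B j k)"
    have "M ** N = mat 1"
      by (simp add: MN matrix_matrix_mult_def mat_def vec_eq_iff inv)
    then have "N ** M = mat 1"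
      by (simp add: matrix_left_right_inverse)
    then show ?thesis
      by (simp add: MN matrix_matrix_mult_def mat_def vec_eq_iff)
  qed
  have S_inj: "Y k = 0" if "\<And>i. (\<Sum>l\<in>UNIV. S i l * Y l) = 0" for Y k
  proof -
    have "0 = (\<Sum>i\<in>UNIV. B i k * (\<Sum>l\<in>UNIV. S i l * Y l))"
      using that by simp
    also have "\<dots> = (\<Sum>l\<in>UNIV. (\<Sum>i\<in>UNIV. B i k * S i l) * Y l)"
      unfolding sum_distrib_left sum_distrib_right by (subst sum.swap) (simp add: mult.assoc)
    also have "\<dots> = (\<Sum>l\<in>UNIV. if l = k then Y k else 0)"
      by (intro sum.cong) (auto simp: inv')
    finally show ?thesis by simp
  qed
  have U: "U i f = (\<Sum>k\<in>UNIV. S i k * H k f)" for i f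
  proof -
    have "(\<Sum>k\<in>UNIV. S i k * H k f) = (\<Sum>j\<in>UNIV. (\<Sum>k\<in>UNIV. S i k * B j k) * U j f)"
      unfolding H sum_distrib_left sum_distrib_right by (subst sum.swap) (simp add: mult.assoc)
    also have "\<dots> = (\<Sum>j\<in>UNIV. if j = i then U i f else 0)"
      by (intro sum.cong) (auto simp: inv)
    finally show ?thesis by simp
  qed
  have U_0: "U i 0 = 0" for i
    using add[of i 0 0] by (simp only: add_0 add_cancel_right_right)
  have U_sum: "U i (sum g A) = (\<Sum>a\<in>A. U i (g a))" for i g and A :: "'n set"
    by (induction A rule: infinite_finite_induct) (simp_all add: U_0 add)
  have UU: "U i (U j f) = (\<Sum>l\<in>UNIV. \<Sum>k\<in>UNIV. S j l * (S i k * H k (H l f)))" if "i \<noteq> j" for i j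
  proof -
    have "U i (U j f) = (\<Sum>l\<in>UNIV. S j l * U i (H l f))"
      unfolding U[of j] by (simp add: U_sum row[OF that])
    then show ?thesis by (simp add: U[of i] sum_distrib_left)
  qed
  define D where "D k l = H k (H l f) - H l (H k f)" for k l
  have "(\<Sum>l\<in>UNIV. S j l * (\<Sum>k\<in>UNIV. S i k * D k l)) = 0" for i j
  proof -
    \<comment> \<open>For \<open>i \<noteq> j\<close> this is \<open>U i (U j f)\<close>, symmetric
      by \<open>comm\<close>. For \<open>i = j\<close> it need not be \<open>U i (U i f)\<close>,
      but its symmetry is trivial.\<close>
    define E where "E i j = (\<Sum>l\<in>UNIV. \<Sum>k\<in>UNIV. S j l * (S i k * H k (H l f)))" for i j
    have "E i j = E j i"
      using comm[of i j f] by (cases "i = j") (simp_all add: E_def UU)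
    \<comment> \<open>Exchanging the names of \<open>k\<close> and \<open>l\<close> restores the
      coefficients of \<open>E i j\<close> and reverses the order of the two operators.\<close>
    moreover have "E j i = (\<Sum>l\<in>UNIV. \<Sum>k\<in>UNIV. S j l * (S i k * H l (H k f)))"
      unfolding E_def by (subst sum.swap) (simp add: mult.left_commute)
    ultimately show ?thesis
      by (simp add: D_def E_def sum_distrib_left right_diff_distrib sum_subtractf)
  qed
  \<comment> \<open>\<open>S_inj\<close> first removes the sum over \<open>l\<close>, using all
    \<open>j\<close>, and then the sum over \<open>k\<close>, using all \<open>i\<close>.\<close>
  then have "(\<Sum>k\<in>UNIV. S i k * D k l) = 0" for i l
    by (rule S_inj)
  then have "D k l = 0"
    by (rule S_inj)
  then show ?thesis by (simp add: D_def)
qed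


section \<open>Partial derivatives of rational functions\<close>

lemma pd_add: "pd i (f + g) = pd i f + pd i g"
proof (cases f; cases g)
  fix a b c d :: "'a cpoly"
  assume "f = Fract a b" "b \<noteq> 0" "g = Fract c d" "d \<noteq> 0"
  then show ?thesis
    by (simp add: pd_Fract eq_fract poly_pd_add poly_pd_mult algebra_simps)
qed

lemma pd_mult: "pd i (f * g) = pd i f * g + f * pd i g"
proof (cases f; cases g)
  fix a b c d :: "'a cpoly"
  assume "f = Fract a b" "b \<noteq> 0" "g = Fract c d" "d \<noteq> 0"
  then show ?thesis
    by (simp add: pd_Fract eq_fract poly_pd_add poly_pd_mult algebra_simps)
qed

lemma poly_pd_1: "poly_pd i 1 = 0"
  using poly_pd_single[of i 0 1] by simp

lemma pd_Fract_1: "pd i (Fract a 1) = Fract (poly_pd i a) 1"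
  by (simp add: pd_Fract poly_pd_1)

lemma pd_0 [simp]: "pd i 0 = 0"
  using pd_add[of i 0 0] by (simp only: add_0 add_cancel_right_right)

lemma pd_1 [simp]: "pd i 1 = 0"
  by (simp add: One_fract_def pd_Fract_1 poly_pd_1 flip: Zero_fract_def)

lemma pd_sum: "pd i (sum f A) = (\<Sum>a\<in>A. pd i (f a))"
  by (induction A rule: infinite_finite_induct) (simp_all add: pd_add)

lemma pd_const [simp]: "pd i (const c) = 0"
  by (simp add: const_def pd_Fract_1 poly_pd_single flip: Zero_fract_def)

lemma pd_var: "pd i (var j) = (if i = j then 1 else 0)"
  by (simp add: var_def pd_Fract_1 poly_pd_single lookup_single when_def One_fract_def Zero_fract_def)

lemma pd_minus: "pd i (- f) = - pd i f"
  using pd_add[of i f "- f"] by (simp add: add_eq_0_iff)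

lemma pd_diff: "pd i (f - g) = pd i f - pd i g"
  using pd_add[of i f "- g"] by (simp add: pd_minus)

lemma pd_mult_eq_0: "pd i f = 0 \<Longrightarrow> pd i g = 0 \<Longrightarrow> pd i (f * g) = 0"
  by (simp add: pd_mult)

lemma pd_prod_eq_0: "(\<And>a. a \<in> A \<Longrightarrow> pd i (f a) = 0) \<Longrightarrow> pd i (prod f A) = 0"
  by (induction A rule: infinite_finite_induct) (simp_all add: pd_mult)

lemma pd_inverse_eq_0:
  assumes "pd i f = 0"
  shows "pd i (inverse f) = 0"
proof (cases "f = 0")
  case False
  then have "f * pd i (inverse f) = pd i 1"
    using pd_mult[of i f "inverse f"] assms by simp
  with False show ?thesis by simp
qed simp

lemma pd_divide_eq_0: "pd i f = 0 \<Longrightarrow> pd i g = 0 \<Longrightarrow> pd i (f / g) = 0"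
  by (simp add: divide_inverse pd_mult_eq_0 pd_inverse_eq_0)

lemma poly_pd_commute: "poly_pd i (poly_pd j p) = poly_pd j (poly_pd i p)"
proof (induction p rule: cpoly_induct)
  case (single m c)
  have "m - Poly_Mapping.single j 1 - Poly_Mapping.single i 1 =
      m - Poly_Mapping.single i 1 - Poly_Mapping.single j (1::nat)"
    by (simp add: diff_diff_eq add.commute)
  then show ?case
    by (cases "i = j") (simp_all add: poly_pd_single lookup_minus lookup_single when_def mult_ac)
qed (simp_all add: poly_pd_add)

text \<open>The commutator \<open>d\<close> of two derivations is again a derivation. It vanishes on
  polynomials, hence on a quotient \<open>f\<close> of \<open>a\<close> by \<open>b\<close>, by the
  product rule for \<open>f * b = a\<close>.\<close>

lemma pd_commute: "pd i (pd j f) = pd j (pd i f)"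
proof (cases f)
  case (Fract a b)
  define d where "d g = pd i (pd j g) - pd j (pd i g)" for g
  have d_poly: "d (Fract p 1) = 0" for p
    by (simp add: d_def pd_Fract_1 poly_pd_commute[of i j])
  have "d (f * Fract b 1) = d f * Fract b 1 + f * d (Fract b 1)"
    by (simp add: d_def pd_mult pd_add algebra_simps)
  moreover have "f * Fract b 1 = Fract a 1"
    using Fract by (simp add: eq_fract)
  moreover have "Fract b 1 \<noteq> 0"
    using Fract by (simp add: eq_fract Zero_fract_def)
  ultimately have "d f = 0"
    by (simp add: d_poly)
  then show ?thesis by (simp add: d_def)
qed

lemma poly_pd_subst_eq_0: "i \<noteq> j \<Longrightarrow> poly_pd i (poly_subst j p) = 0"
  by (induction p rule: cpoly_induct)
    (simp_all add: poly_subst_single poly_pd_single poly_subst_add poly_pd_add lookup_single when_def)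

lemma pd_subst_eq_0: "i \<noteq> j \<Longrightarrow> pd i (subst j f) = 0"
  by (cases f)
    (simp add: subst_Fract pd_Fract poly_subst_eq_0_iff poly_pd_subst_eq_0 Zero_fract_def eq_fract)

lemma pd_funpow_add: "(pd i ^^ m) (f + g) = (pd i ^^ m) f + (pd i ^^ m) g"
  by (induction m) (simp_all add: pd_add)

lemma pd_funpow_mult_left: "pd i g = 0 \<Longrightarrow> (pd i ^^ m) (g * f) = g * (pd i ^^ m) f"
  by (induction m) (simp_all add: pd_mult)

lemma pd_funpow_commute: "pd j ((pd i ^^ m) f) = (pd i ^^ m) (pd j f)"
  by (induction m) (simp_all add: pd_commute[of j])


section \<open>Operators acting on one variable\<close>

lemma on_var_add:
  assumes "rational_diff_op T"
  shows "on_var i T (f + g) = on_var i T f + on_var i T g"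
  using assms
  by (auto simp: rational_diff_op_def on_var_diff_op pd_funpow_add distrib_left sum.distrib)

text \<open>A function free of the \<open>i\<close>th variable is a scalar for every power of
  \<open>pd i\<close>. This covers both the rows of \<open>S\<close> and the coefficients of the
  operator on another variable.\<close>

lemma on_var_mult_left:
  assumes "rational_diff_op T" "pd i g = 0"
  shows "on_var i T (g * f) = g * on_var i T f"
  using assms
  by (auto simp: rational_diff_op_def on_var_diff_op pd_funpow_mult_left sum_distrib_left mult.left_commute)

lemma on_var_sum:
  assumes "rational_diff_op T"
  shows "on_var i T (sum f A) = (\<Sum>a\<in>A. on_var i T (f a))"
proof -
  have "on_var i T 0 = 0"
    using on_var_add[OF assms, of i 0 0] by (simp only: add_0 add_cancel_right_right)
  then show ?thesis
    by (induction A rule: infinite_finite_induct) (simp_all add: on_var_add[OF assms])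
qed

lemma pd_funpow_on_var:
  assumes "rational_diff_op T" "i \<noteq> j"
  shows "(pd j ^^ n) (on_var i T f) = on_var i T ((pd j ^^ n) f)"
proof (induction n)
  case (Suc n)
  have "pd j (on_var i T h) = on_var i T (pd j h)" for h
    using assms
    by (auto simp: rational_diff_op_def on_var_diff_op pd_sum pd_mult pd_subst_eq_0 pd_funpow_commute)
  with Suc show ?case by simp
qed simp

text \<open>For \<open>i \<noteq> j\<close> only the operator on the \<open>j\<close>th variable is
  expanded: the other one passes through its coefficients, which are free of the \<open>i\<close>th
  variable, and through the powers of \<open>pd j\<close>.\<close>

lemma on_var_commute:
  assumes T: "rational_diff_op T"
  shows "on_var i T (on_var j T f) = on_var j T (on_var i T f)"
proof (cases "i = j")
  case False
  obtain c where c: "T = diff_op c"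
    using T by (auto simp: rational_diff_op_def)
  have expand: "on_var j T h = (\<Sum>m\<in>Poly_Mapping.keys c.
      subst j (Poly_Mapping.lookup c m) * (pd j ^^ Poly_Mapping.lookup m ()) h)" for h
    by (simp add: c on_var_diff_op)
  show ?thesis
    unfolding expand using False
    by (simp add: on_var_sum[OF T] on_var_mult_left[OF T] pd_subst_eq_0 pd_funpow_on_var[OF T])
qed simp

section \<open>Closure properties of rational differential operators\<close>

lemma rational_diff_op_monom: "rational_diff_op (\<lambda>f. a * pds \<alpha> f)"
proof -
  have "diff_op (Poly_Mapping.single \<alpha> a) = (\<lambda>f. a * pds \<alpha> f)"
    by (cases "a = 0") (simp_all add: diff_op_def fun_eq_iff)
  then show ?thesis unfolding rational_diff_op_def by metis
qed

lemma diff_op_add: "diff_op (c + d) f = diff_op c f + diff_op d f"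
  unfolding diff_op_def
  by (rule setsum_keys_plus_distrib) (simp_all add: distrib_right)

lemma rational_diff_op_sum:
  assumes "\<And>a. a \<in> A \<Longrightarrow> rational_diff_op (D a)"
  shows "rational_diff_op (\<lambda>f. \<Sum>a\<in>A. D a f)"
  using assms
proof (induction A rule: infinite_finite_induct)
  case (insert a A)
  then obtain c d where "D a = diff_op c" "(\<lambda>f. \<Sum>a\<in>A. D a f) = diff_op d"
    by (metis insertCI rational_diff_op_def)
  then have "(\<lambda>f. \<Sum>b\<in>insert a A. D b f) = diff_op (c + d)"
    using insert(1,2) by (simp add: fun_eq_iff diff_op_add)
  then show ?case by (auto simp: rational_diff_op_def)
\<comment> \<open>Empty and infinite index sets both give the zero operator, a monomial with
  coefficient 0.\<close>
qed (use rational_diff_op_monom[of 0 0] in simp_all)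

text \<open>Each variable occurs once in the list defining \<open>pds\<close>, and every factor
  except the one for \<open>i\<close> is a zeroth power. This brings the terms of
  \<open>on_var\<close> into the form \<open>diff_op\<close> requires.\<close>

lemma pds_single: "pds (Poly_Mapping.single i n) = pd i ^^ n"
proof -
  have "foldr (\<lambda>j. pd j ^^ Poly_Mapping.lookup (Poly_Mapping.single i n) j) xs =
      (if i \<in> set xs then pd i ^^ n else id)" if "distinct xs" for xs
    using that by (induction xs) (auto simp: lookup_single when_def id_def)
  then show ?thesis by (simp add: pds_def)
qed

lemma rational_diff_op_mult_on_var:
  assumes "rational_diff_op T"
  shows "rational_diff_op (\<lambda>f. a * on_var i T f)"
proof -
  obtain c where c: "T = diff_op c"
    using assms by (auto simp: rational_diff_op_def)
  have "rational_diff_op (\<lambda>f. \<Sum>m\<in>Poly_Mapping.keys c.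
      a * subst i (Poly_Mapping.lookup c m) * pds (Poly_Mapping.single i (Poly_Mapping.lookup m ())) f)"
    by (intro rational_diff_op_sum rational_diff_op_monom)
  then show ?thesis
    by (simp add: c on_var_diff_op pds_single sum_distrib_left mult_ac)
qed

section \<open>Distinctness of the Cauchy nodes, and the theorem\<close>

lemma inj_const: "inj const"
  by (rule injI) (auto simp: const_def eq_fract dest: injD[OF inj_single])

text \<open>Derivatives tell the variables apart: \<open>pd i\<close> is 1 on \<open>var i\<close>
  and 0 on any other variable.\<close>

lemma inj_var: "inj var"
proof (rule injI)
  fix i j :: 'a
  assume "var i = var j"
  then have "pd i (var i) = pd i (var j)" by simp
  then show "i = j" by (simp add: pd_var split: if_splits)
qed

lemma var_neq_const: "var i \<noteq> const c"
proof
  assume "var i = const c"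
  then have "pd i (var i) = pd i (const c)" by simp
  then show False by (simp add: pd_var)
qed

theorem theorem4p1:
  fixes T :: "unit ratfun \<Rightarrow> unit ratfun"
    and P :: "'n::{finite,linorder} \<Rightarrow> complex"
    and H :: "'n \<Rightarrow> 'n ratfun \<Rightarrow> 'n ratfun"
  assumes T: "rational_diff_op T"
    and P: "inj P"
    and H: "\<And>k f. H k f =
      (\<Sum>i\<in>UNIV.
         (\<Prod>(i', k') \<in> {(i', k'). i' = i \<or> k' = k}. var i' - const (P k'))
           / (\<Prod>i' \<in> {i'. i' \<noteq> i}. var i - var i')
         * on_var i T f)"
  shows "(\<forall>k. rational_diff_op (H k)) \<and> (\<forall>k l. H k \<circ> H l = H l \<circ> H k)"
proof (intro conjI allI)
  show "rational_diff_op (H k)" for k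
    unfolding H[abs_def] by (intro rational_diff_op_sum rational_diff_op_mult_on_var T)
  define x y :: "'n \<Rightarrow> 'n ratfun" where xy: "x = var" "y = (\<lambda>k. const (P k))"
  define S where "S i k = 1 / ((x i - y k) * (\<Prod>k'\<in>-{k}. y k' - y k))" for i k
  define B where "B i k = (\<Prod>k'\<in>UNIV. x i - y k') * (\<Prod>i'\<in>-{i}. x i' - y k)
      / (\<Prod>i'\<in>-{i}. x i - x i')" for i k
  have "inj y"
    using P by (auto simp: xy inj_def dest: injD[OF inj_const])
  then have inv: "(\<Sum>k\<in>UNIV. S i k * B j k) = (if i = j then 1 else 0)" for i j
    unfolding S_def B_def
    by (intro cauchy_matrix_right_inverse) (simp_all add: xy inj_var var_neq_const)
  have row: "on_var i T (S j l * f) = S j l * on_var i T f" if "i \<noteq> j" for i j l f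
    using that unfolding S_def xy
    \<comment> \<open>Apart from constants, \<open>S j l\<close> involves only \<open>var j\<close>,
      which \<open>pd i\<close> annihilates.\<close>
    by (intro on_var_mult_left[OF T] pd_divide_eq_0 pd_mult_eq_0 pd_prod_eq_0)
      (simp_all add: pd_diff pd_var)
  have "(\<Prod>(i', k') \<in> {(i', k'). i' = i \<or> k' = k}. x i' - y k') =
      (\<Prod>k'\<in>UNIV. x i - y k') * (\<Prod>i'\<in>-{i}. x i' - y k)" for i k
  proof -
    \<comment> \<open>The cross of pairs splits into the full row \<open>i\<close> and the column
      \<open>k\<close> without its entry in that row, so \<open>(i, k)\<close> is counted
      once.\<close>
    have "{(i', k'). i' = i \<or> k' = k} = {i} \<times> UNIV \<union> (-{i}) \<times> {k}"
      by auto
    moreover have "{i} \<times> UNIV \<inter> (-{i}) \<times> {k} = {}"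
      by auto
    ultimately show ?thesis
      by (simp add: prod.union_disjoint flip: prod.cartesian_product)
  qed
  moreover have "{i'. i' \<noteq> i} = -{i}" for i :: 'n
    by auto
  ultimately have H_B: "H k f = (\<Sum>i\<in>UNIV. B i k * on_var i T f)" for k f
    by (simp add: H B_def xy)
  have "H k (H l f) = H l (H k f)" for k l f
    by (rule commute_if_rows_separated[OF on_var_add[OF T] on_var_commute[OF T] row inv H_B])
  then show "H k \<circ> H l = H l \<circ> H k" for k l
    by (simp add: fun_eq_iff)
qed

end
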